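(* Let $n\ge 2$, $m\ge1$. Assume that $\alpha_i>1$ and $l_i>0$ for every $i\in\{1,\dots,m\}$, and that $g:\mathbb{R}^n\to\mathbb{R}$ is locally Lipschitz continuous on $\mathbb{R}^n$. Then for every $\mathbf{y}\in\Omega$ and every $\mathbf{p}=(p_{P_1}^\top,\dots,p_{P_m}^\top,p_E^\top)^\top\in D^-V^g(\mathbf{y})$, $$-\sum_{i=1}^m\alpha_i\|p_{P_i}\|+\|p_E\|=0.$$
   Context: $\|\cdot\|$ is the Euclidean norm. Points of $\mathbb{R}^{(m+1)n}$ are written $\mathbf{y}=(x_{P_1}^\top,\dots,x_{P_m}^\top,x_E^\top)^\top$ with blocks in $\mathbb{R}^n$, and similarly for $\mathbf{p}$. $\Omega=\{\mathbf{y}:\|x_{P_i}-x_E\|>l_i\ \text{for all } i\}$. For $\mathbf{y}\in\Omega$: $d_i(x;x_{P_i},x_E)=-\|x-x_{P_i}\|+\alpha_i\|x-x_E\|+l_i$, $\mathcal{D}_i(x_{P_i},x_E)=\{x\in\mathbb{R}^n:d_i(x;x_{P_i},x_E)\le 0\}$, $\mathcal{D}^*(\mathbf{y})=\bigcap_{i=1}^m\mathcal{D}_i(x_{P_i},x_E)$, $V^g(\mathbf{y})=\min_{x\in\mathcal{D}^*(\mathbf{y})}g(x)$. The subdifferential $D^-f(\mathbf{y})$ of $f:\Omega\to\mathbb{R}$ is the set of $\mathbf{p}\in\mathbb{R}^{(m+1)n}$ with $\liminf_{\mathbf{y}'\to\mathbf{y}}\frac{f(\mathbf{y}')-f(\mathbf{y})-\mathbf{p}^\top(\mathbf{y}'-\mathbf{y})}{\|\mathbf{y}'-\mathbf{y}\|}\ge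 0$. *)

theory Defs
  imports "HOL-Analysis.Analysis"
begin

text \<open>
  A point of $R^{(m+1)n}$ is a pair: the vector of the \<open>m\<close> pursuer blocks and the evader block.
  The norm and inner product of this product type are the Euclidean ones of $R^{(m+1)n}$.
\<close>

type_synonym ('n, 'm) state = "((real ^ 'n) ^ 'm) \<times> (real ^ 'n)"

definition locally_lipschitz :: "('a::metric_space \<Rightarrow> 'b::metric_space) \<Rightarrow> bool" where
  "locally_lipschitz g \<longleftrightarrow> (\<forall>x. \<exists>r>0. \<exists>L. L-lipschitz_on (ball x r) g)"

definition Omega :: "('m \<Rightarrow> real) \<Rightarrow> ('n::finite, 'm::finite) state set" where
  "Omega l = {(xP, xE). \<forall>i. norm (xP $ i - xE) > l i}"

definition dfun :: "real \<Rightarrow> real \<Rightarrow> real ^ 'n::finite \<Rightarrow> real ^ 'n \<Rightarrow> real ^ 'n \<Rightarrow> real" where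
  "dfun a r x xP xE = - norm (x - xP) + a * norm (x - xE) + r"

definition Dset :: "real \<Rightarrow> real \<Rightarrow> real ^ 'n::finite \<Rightarrow> real ^ 'n \<Rightarrow> (real ^ 'n) set" where
  "Dset a r xP xE = {x. dfun a r x xP xE \<le> 0}"

definition Dstar ::
  "('m \<Rightarrow> real) \<Rightarrow> ('m \<Rightarrow> real) \<Rightarrow> ('n::finite, 'm::finite) state \<Rightarrow> (real ^ 'n) set" where
  "Dstar \<alpha> l y = (\<Inter>i. Dset (\<alpha> i) (l i) (fst y $ i) (snd y))"

text \<open>
  The minimum of \<open>g\<close> over \<open>Dstar \<alpha> l y\<close>. For \<open>y\<close> in \<open>Omega l\<close> and all \<open>\<alpha> i > 1\<close> this set is
  compact and contains the evader position, so a continuous \<open>g\<close> attains its minimum on it.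
  Outside \<open>Omega l\<close> the value may be unspecified and is never used.
\<close>

definition Vg ::
  "('m \<Rightarrow> real) \<Rightarrow> ('m \<Rightarrow> real) \<Rightarrow> (real ^ 'n \<Rightarrow> real) \<Rightarrow> ('n::finite, 'm::finite) state \<Rightarrow> real" where
  "Vg \<alpha> l g y = (LEAST v. v \<in> g ` Dstar \<alpha> l y)"

text \<open>The subdifferential of \<open>f : S \<rightarrow> R\<close>; the lower limit is over points of the domain \<open>S\<close>.\<close>

definition subdifferential :: "'a::euclidean_space set \<Rightarrow> ('a \<Rightarrow> real) \<Rightarrow> 'a \<Rightarrow> 'a set" where
  "subdifferential S f y =
     {p. Liminf (at y within S)
           (\<lambda>y'. ereal ((f y' - f y - p \<bullet> (y' - y)) / norm (y' - y))) \<ge> 0}"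

end

theory Submission
  imports Defs
begin

text \<open>
  Let \<open>x\<close> minimise \<open>g\<close> over \<open>Dstar \<alpha> l y\<close>. As long as \<open>x\<close> stays in \<open>Dstar \<alpha> l y'\<close>, the value at
  \<open>y'\<close> is at most \<open>g x\<close>, the value at \<open>y\<close>; hence \<open>p \<bullet> \<delta> \<le> 0\<close> for every direction \<open>\<delta>\<close> that keeps
  \<open>x\<close> admissible. If \<open>x\<close> is the evader position, no constraint is active and \<open>p = 0\<close>. Otherwise
  let \<open>e\<^sub>i\<close> and \<open>e\<close> be the unit vectors from \<open>x\<close> to the pursuers and to the evader; the
  inequality holds whenever \<open>\<alpha>\<^sub>i (e \<bullet> \<delta>\<^sub>E) \<le> e\<^sub>i \<bullet> \<delta>\<^sub>i\<close> for all \<open>i\<close>. This forces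
  \<open>p\<^sub>i = - \<parallel>p\<^sub>i\<parallel> e\<^sub>i\<close> and then \<open>p\<^sub>E = (\<Sum>i. \<alpha>\<^sub>i \<parallel>p\<^sub>i\<parallel>) e\<close>.
\<close>

section \<open>Subgradients along directions in which the function does not increase\<close>

text \<open>On the ray in direction \<open>\<delta>\<close>, near \<open>y\<close>, the difference
  quotient is at most \<open>- (p \<bullet> \<delta>) / norm \<delta>\<close>, so a nonnegative
  lower limit leaves no room for \<open>p \<bullet> \<delta> > 0\<close>.\<close>

lemma subdifferential_inner_nonpos:
  assumes p: "p \<in> subdifferential S f y"
    and ev: "eventually (\<lambda>t. y + t *\<^sub>R \<delta> \<in> S \<and> f (y + t *\<^sub>R \<delta>) \<le> f y) (at_right (0::real))"
  shows "p \<bullet> \<delta> \<le> 0"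
proof (cases "\<delta> = 0")
  case False
  have "p \<bullet> \<delta> \<le> 0 + \<epsilon>" if "\<epsilon> > 0" for \<epsilon>
  proof -
    \<comment> \<open>Scaled so that multiplying the quotient by
      \<open>norm (t *\<^sub>R \<delta>)\<close> leaves an error of exactly
      \<open>t * \<epsilon>\<close>.\<close>
    define \<eta> where "\<eta> = \<epsilon> / norm \<delta>"
    have "\<eta> > 0" using that False by (simp add: \<eta>_def)
    have "(0::ereal) \<le> Liminf (at y within S)
        (\<lambda>y'. ereal ((f y' - f y - p \<bullet> (y' - y)) / norm (y' - y)))"
      using p by (simp add: subdifferential_def)
    moreover have "ereal (- \<eta>) < 0" using \<open>\<eta> > 0\<close> by simp
    ultimately have "eventually (\<lambda>y'. ereal (- \<eta>)
        < ereal ((f y' - f y - p \<bullet> (y' - y)) / norm (y' - y))) (at y within S)"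
      by (subst (asm) le_Liminf_iff) blast
    then have E: "eventually (\<lambda>y'. - \<eta> < (f y' - f y - p \<bullet> (y' - y)) / norm (y' - y))
        (at y within S)" by simp
    have lim: "filterlim (\<lambda>t. y + t *\<^sub>R \<delta>) (at y within S) (at_right 0)"
      unfolding filterlim_at
    proof
      show "eventually (\<lambda>t. y + t *\<^sub>R \<delta> \<in> S \<and> y + t *\<^sub>R \<delta> \<noteq> y) (at_right 0)"
        using ev eventually_at_right_less[of "0::real"]
        by eventually_elim (use False in auto)
      have "((\<lambda>t. y + t *\<^sub>R \<delta>) \<longlongrightarrow> y + 0 *\<^sub>R \<delta>) (at_right 0)"
        by (intro tendsto_intros)
      then show "((\<lambda>t. y + t *\<^sub>R \<delta>) \<longlongrightarrow> y) (at_right 0)" by simp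
    qed
    have "eventually (\<lambda>t. p \<bullet> \<delta> \<le> \<epsilon>) (at_right (0::real))"
      using ev eventually_at_right_less[of "0::real"] eventually_compose_filterlim[OF E lim]
    proof eventually_elim
      case (elim t)
      then have "- \<eta> * (t * norm \<delta>) < f (y + t *\<^sub>R \<delta>) - f y - t * (p \<bullet> \<delta>)"
        using False by (simp add: pos_less_divide_eq)
      also have "\<dots> \<le> - t * (p \<bullet> \<delta>)" using elim by simp
      finally have "t * (p \<bullet> \<delta>) < t * \<epsilon>" using False by (simp add: \<eta>_def mult.commute)
      then show ?case using elim by simp
    qed
    then show ?thesis by (simp add: eventually_const)
  qed
  then show ?thesis by (rule field_le_epsilon)
qed simp

section \<open>Compactness and attainment of the minimum\<close>

lemma locally_lipschitz_imp_continuous_on: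
  assumes "locally_lipschitz g"
  shows "continuous_on S g"
proof -
  have "isCont g x" for x
  proof -
    obtain r L where "r > 0" "L-lipschitz_on (ball x r) g"
      using assms unfolding locally_lipschitz_def by blast
    then show ?thesis
      using lipschitz_on_continuous_on continuous_on_eq_continuous_at[OF open_ball] centre_in_ball
      by blast
  qed
  then show ?thesis by (simp add: continuous_at_imp_continuous_on)
qed

lemma open_Omega: "open (Omega l)"
proof -
  have "Omega l = (\<Inter>i. {z. l i < norm (fst z $ i - snd z)})"
    by (auto simp: Omega_def)
  also have "open \<dots>"
    by (intro open_INT ballI open_Collect_less continuous_intros) auto
  finally show ?thesis .
qed

text \<open>Since \<open>a > 1\<close>, the term \<open>a * norm (x - xE)\<close> outgrows
  \<open>norm (x - xP)\<close>; the triangle inequality turns this into an explicit ball around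
  \<open>xE\<close>.\<close>

lemma compact_Dset:
  assumes "a > 1"
  shows "compact (Dset a r xP xE)"
proof -
  have "closed (Dset a r xP xE)"
    unfolding Dset_def dfun_def by (intro closed_Collect_le continuous_intros)
  moreover have "Dset a r xP xE \<subseteq> cball xE ((norm (xE - xP) - r) / (a - 1))"
  proof
    fix x assume "x \<in> Dset a r xP xE"
    then have "a * norm (x - xE) + r \<le> norm (x - xP)" by (simp add: Dset_def dfun_def)
    also have "\<dots> \<le> norm (x - xE) + norm (xE - xP)"
      by (metis add_diff_eq diff_add_cancel norm_triangle_ineq)
    finally have "norm (x - xE) * (a - 1) \<le> norm (xE - xP) - r" by (simp add: algebra_simps)
    then show "x \<in> cball xE ((norm (xE - xP) - r) / (a - 1))"
      using assms by (simp add: dist_norm norm_minus_commute pos_le_divide_eq)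
  qed
  ultimately show ?thesis
    using bounded_cball bounded_subset compact_eq_bounded_closed by blast
qed

lemma compact_Dstar:
  assumes "\<And>i. \<alpha> i > 1"
  shows "compact (Dstar \<alpha> l y)"
  unfolding Dstar_def by (intro compact_Inter) (auto intro: compact_Dset assms)

lemma snd_in_Dstar:
  assumes "y \<in> Omega l"
  shows "snd y \<in> Dstar \<alpha> l y"
  using assms
  by (auto simp: Omega_def Dstar_def Dset_def dfun_def norm_minus_commute less_imp_le)

lemma Vg_is_min:
  assumes "\<And>i. \<alpha> i > 1" and "locally_lipschitz g" and "y \<in> Omega l"
  obtains x where "x \<in> Dstar \<alpha> l y" and "Vg \<alpha> l g y = g x"
    and "\<And>z. z \<in> Dstar \<alpha> l y \<Longrightarrow> g x \<le> g z"
proof -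
  obtain x where x: "x \<in> Dstar \<alpha> l y" "\<forall>z\<in>Dstar \<alpha> l y. g x \<le> g z"
    using continuous_attains_inf[OF compact_Dstar _ locally_lipschitz_imp_continuous_on]
      snd_in_Dstar assms by (metis empty_iff)
  then have "Vg \<alpha> l g y = g x"
    unfolding Vg_def by (intro Least_equality) auto
  with x show thesis using that by blast
qed

section \<open>Directions that keep a point admissible\<close>

text \<open>The last assumption says that \<open>dfun\<close> has negative derivative along the
  motion. Strictness matters: on an active constraint a zero derivative would not decide the
  sign.\<close>

lemma dfun_decreasing_direction:
  fixes x xP xE :: "real ^ 'n::finite"
  assumes "x \<noteq> xP" and "x \<noteq> xE" and "dfun a r x xP xE \<le> 0"
    and dir: "a * (sgn (xE - x) \<bullet> dE) < sgn (xP - x) \<bullet> dP"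
  shows "eventually (\<lambda>t. dfun a r x (xP + t *\<^sub>R dP) (xE + t *\<^sub>R dE) \<le> 0) (at_right 0)"
proof -
  have norm_deriv: "((\<lambda>t. norm (x - (z + t *\<^sub>R d))) has_real_derivative sgn (z - x) \<bullet> d) (at 0)"
    if "x \<noteq> z" for z d :: "real ^ 'n"
  proof -
    have "((\<lambda>t. (z - x) + t *\<^sub>R d) has_derivative (\<lambda>h. h *\<^sub>R d)) (at 0)"
      by (auto intro!: derivative_eq_intros)
    moreover have "(norm has_derivative (\<lambda>h. h \<bullet> sgn (z - x))) (at ((z - x) + 0 *\<^sub>R d))"
      using has_derivative_norm[of "z - x"] that by simp
    ultimately have
      "((\<lambda>t. norm ((z - x) + t *\<^sub>R d)) has_derivative (\<lambda>h. (h *\<^sub>R d) \<bullet> sgn (z - x))) (at 0)"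
      by (rule has_derivative_compose)
    moreover have "norm (x - (z + t *\<^sub>R d)) = norm ((z - x) + t *\<^sub>R d)" for t
      by (subst norm_minus_commute) (simp add: algebra_simps)
    ultimately show ?thesis
      by (simp add: has_field_derivative_def inner_commute mult_commute_abs)
  qed
  have "((\<lambda>t. dfun a r x (xP + t *\<^sub>R dP) (xE + t *\<^sub>R dE)) has_real_derivative
      - (sgn (xP - x) \<bullet> dP) + a * (sgn (xE - x) \<bullet> dE)) (at 0)"
    unfolding dfun_def
    by (auto intro!: derivative_eq_intros norm_deriv[OF assms(1)] norm_deriv[OF assms(2)])
  from DERIV_neg_dec_right[OF this] dir obtain d where "d > 0" and d: "\<And>h. 0 < h \<Longrightarrow> h < d \<Longrightarrow>
      dfun a r x (xP + h *\<^sub>R dP) (xE + h *\<^sub>R dE) < dfun a r x xP xE"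
    by auto
  show ?thesis
    unfolding eventually_at_right_field
  proof (intro exI conjI allI impI)
    show "dfun a r x (xP + h *\<^sub>R dP) (xE + h *\<^sub>R dE) \<le> 0" if "0 < h" "h < d" for h
      using d[OF that] assms(3) by simp
  qed (fact \<open>d > 0\<close>)
qed

text \<open>Continuity suffices here, so \<open>x = xE\<close> is covered too, where the norm is not
  differentiable.\<close>

lemma dfun_inactive:
  assumes "dfun a r x xP xE < 0"
  shows "eventually (\<lambda>t. dfun a r x (xP + t *\<^sub>R dP) (xE + t *\<^sub>R dE) \<le> 0) (at_right 0)"
proof -
  have "((\<lambda>t. dfun a r x (xP + t *\<^sub>R dP) (xE + t *\<^sub>R dE)) \<longlongrightarrow>
      dfun a r x (xP + 0 *\<^sub>R dP) (xE + 0 *\<^sub>R dE)) (at_right 0)"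
    unfolding dfun_def by (intro tendsto_intros)
  then have "eventually (\<lambda>t. dfun a r x (xP + t *\<^sub>R dP) (xE + t *\<^sub>R dE) < 0) (at_right 0)"
    using assms by (intro order_tendstoD(2)) auto
  then show ?thesis by eventually_elim simp
qed

lemma Vg_subdifferential_inner_nonpos:
  fixes g :: "real ^ 'n::finite \<Rightarrow> real"
    and \<alpha> l :: "'m::finite \<Rightarrow> real"
    and y p \<delta> :: "('n, 'm) state"
  assumes "\<And>i. \<alpha> i > 1" and "locally_lipschitz g" and "y \<in> Omega l"
    and "p \<in> subdifferential (Omega l) (Vg \<alpha> l g) y"
    and x: "Vg \<alpha> l g y = g x"
    and adm: "\<And>i. eventually (\<lambda>t. dfun (\<alpha> i) (l i) x
      (fst y $ i + t *\<^sub>R (fst \<delta> $ i)) (snd y + t *\<^sub>R snd \<delta>) \<le> 0) (at_right 0)"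
  shows "p \<bullet> \<delta> \<le> 0"
proof (rule subdifferential_inner_nonpos[OF assms(4)])
  have "((\<lambda>t. y + t *\<^sub>R \<delta>) \<longlongrightarrow> y + 0 *\<^sub>R \<delta>) (at_right 0)"
    by (intro tendsto_intros)
  then have inO: "eventually (\<lambda>t. y + t *\<^sub>R \<delta> \<in> Omega l) (at_right 0)"
    using topological_tendstoD[OF _ open_Omega] assms(3) by fastforce
  \<comment> \<open>As there are finitely many pursuers, one range of small \<open>t\<close> serves
    all constraints; on it \<open>x\<close> competes in the minimum at the displaced state.\<close>
  have "eventually (\<lambda>t. \<forall>i. dfun (\<alpha> i) (l i) x
      (fst y $ i + t *\<^sub>R (fst \<delta> $ i)) (snd y + t *\<^sub>R snd \<delta>) \<le> 0) (at_right 0)"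
    using adm by (simp add: eventually_all_finite)
  with inO show "eventually (\<lambda>t. y + t *\<^sub>R \<delta> \<in> Omega l \<and>
      Vg \<alpha> l g (y + t *\<^sub>R \<delta>) \<le> Vg \<alpha> l g y) (at_right 0)"
  proof eventually_elim
    case (elim t)
    then have "x \<in> Dstar \<alpha> l (y + t *\<^sub>R \<delta>)" by (simp add: Dstar_def Dset_def)
    moreover obtain z where "Vg \<alpha> l g (y + t *\<^sub>R \<delta>) = g z"
        and "\<And>w. w \<in> Dstar \<alpha> l (y + t *\<^sub>R \<delta>) \<Longrightarrow> g z \<le> g w"
      by (rule Vg_is_min[of \<alpha> g "y + t *\<^sub>R \<delta>" l]) (use assms(1,2) elim(1) in auto)
    ultimately have "Vg \<alpha> l g (y + t *\<^sub>R \<delta>) \<le> g x" by simp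
    then show ?case using elim(1) x by simp
  qed
qed

section \<open>Duality and the norm identity\<close>

lemma inner_self_nonpos_iff: "x \<bullet> x \<le> 0 \<longleftrightarrow> x = 0" for x :: "'a::real_inner"
  by (metis inner_eq_zero_iff inner_ge_zero order_antisym)

lemma inner_state:
  fixes p q :: "('n::finite, 'm::finite) state"
  shows "p \<bullet> q = (\<Sum>i\<in>UNIV. fst p $ i \<bullet> fst q $ i) + snd p \<bullet> snd q"
  by (simp add: inner_prod_def inner_vec_def)

text \<open>The conclusion of Farkas' lemma, here with explicit multipliers \<open>norm (fst p $ i)\<close>.\<close>

lemma dual_cone_norm_eq:
  fixes p :: "('n::finite, 'm::finite) state" and e :: "real ^ 'n" and u :: "'m \<Rightarrow> real ^ 'n"
  assumes "norm e = 1" and u: "\<And>i. norm (u i) = 1" and \<alpha>: "\<And>i. \<alpha> i \<ge> 0"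
    and nonpos: "\<And>\<delta> :: ('n, 'm) state.
      (\<And>i. \<alpha> i * (e \<bullet> snd \<delta>) \<le> u i \<bullet> fst \<delta> $ i) \<Longrightarrow> p \<bullet> \<delta> \<le> 0"
  shows "norm (snd p) = (\<Sum>i\<in>UNIV. \<alpha> i * norm (fst p $ i))"
proof -
  have uu: "u i \<bullet> u i = 1" for i using u by (simp add: norm_eq_1)
  have single: "fst p $ i \<bullet> v \<le> 0" if "u i \<bullet> v \<ge> 0" for i v
  proof -
    \<comment> \<open>Only pursuer \<open>i\<close> moves, so the inequalities for all other indices
      read \<open>0 \<le> 0\<close>.\<close>
    define \<delta> :: "('n, 'm) state" where "\<delta> = ((\<chi> j. if j = i then v else 0), 0)"
    have "p \<bullet> \<delta> \<le> 0" by (rule nonpos) (use that in \<open>simp add: \<delta>_def\<close>)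
    moreover have "p \<bullet> \<delta> = (\<Sum>j\<in>UNIV. if j = i then fst p $ j \<bullet> v else 0)"
      by (simp add: inner_state \<delta>_def if_distrib cong: if_cong)
    ultimately show ?thesis by simp
  qed
  have norm_p: "fst p $ i \<bullet> u i = - norm (fst p $ i)" for i
  proof -
    define c where "c = fst p $ i \<bullet> u i"
    have "c \<le> 0" unfolding c_def by (rule single) (simp add: uu)
    \<comment> \<open>The part of \<open>fst p $ i\<close> orthogonal to \<open>u i\<close> is
      itself a permitted test vector, and testing with it bounds its squared norm by 0.\<close>
    have orth: "u i \<bullet> (fst p $ i - c *\<^sub>R u i) = 0"
      by (simp add: inner_diff_right uu c_def inner_commute)
    have "(fst p $ i - c *\<^sub>R u i) \<bullet> (fst p $ i - c *\<^sub>R u i)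
        = fst p $ i \<bullet> (fst p $ i - c *\<^sub>R u i)"
      using orth by (simp add: inner_diff_left)
    also have "\<dots> \<le> 0" by (rule single) (simp add: orth)
    finally have "fst p $ i = c *\<^sub>R u i" by (simp add: inner_self_nonpos_iff)
    then have "norm (fst p $ i) = norm (c *\<^sub>R u i)" by simp
    then show ?thesis using \<open>c \<le> 0\<close> u by (simp add: c_def)
  qed
  define s where "s = (\<Sum>i\<in>UNIV. \<alpha> i * norm (fst p $ i))"
  have "(snd p - s *\<^sub>R e) \<bullet> v \<le> 0" for v
  proof -
    \<comment> \<open>The pursuer blocks are chosen to turn every inequality into an equality, so
      \<open>v\<close> is arbitrary; \<open>v = snd p - s *\<^sub>R e\<close> then gives
      \<open>snd p = s *\<^sub>R e\<close>.\<close>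
    define \<delta> :: "('n, 'm) state" where "\<delta> = ((\<chi> i. (\<alpha> i * (e \<bullet> v)) *\<^sub>R u i), v)"
    have "p \<bullet> \<delta> \<le> 0" by (rule nonpos) (simp add: \<delta>_def uu)
    moreover have "p \<bullet> \<delta> = - (s * (e \<bullet> v)) + snd p \<bullet> v"
      by (simp add: inner_state \<delta>_def norm_p s_def sum_distrib_left sum_negf algebra_simps)
    ultimately show ?thesis by (simp add: inner_diff_left)
  qed
  then have "snd p = s *\<^sub>R e" by (metis inner_self_nonpos_iff eq_iff_diff_eq_0)
  moreover have "s \<ge> 0" unfolding s_def by (intro sum_nonneg mult_nonneg_nonneg \<alpha>) simp
  ultimately show ?thesis using assms(1) by (simp add: s_def)
qed

theorem proposition4p6:
  fixes g :: "real ^ 'n::finite \<Rightarrow> real"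
    and \<alpha> l :: "'m::finite \<Rightarrow> real"
    and y p :: "('n, 'm) state"
  assumes "CARD('n) \<ge> 2"
    and "\<And>i. \<alpha> i > 1"
    and "\<And>i. l i > 0"
    and "locally_lipschitz g"
    and "y \<in> Omega l"
    and "p \<in> subdifferential (Omega l) (Vg \<alpha> l g) y"
  shows "- (\<Sum>i\<in>UNIV. \<alpha> i * norm (fst p $ i)) + norm (snd p) = 0"
proof -
  obtain x where x: "x \<in> Dstar \<alpha> l y" and V: "Vg \<alpha> l g y = g x"
    by (rule Vg_is_min[of \<alpha> g y l]) (use assms in auto)
  note nonpos = Vg_subdifferential_inner_nonpos[OF assms(2,4,5,6) V]
  have le: "dfun (\<alpha> i) (l i) x (fst y $ i) (snd y) \<le> 0" for i
    using x by (simp add: Dstar_def Dset_def)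
  show ?thesis
  proof (cases "x = snd y")
    case True
    have "dfun (\<alpha> i) (l i) x (fst y $ i) (snd y) < 0" for i
      using assms(5) True by (auto simp: Omega_def dfun_def norm_minus_commute)
    \<comment> \<open>With all constraints inactive every direction is allowed, in particular
      \<open>p\<close> itself.\<close>
    then have "p \<bullet> p \<le> 0" by (intro nonpos dfun_inactive)
    then show ?thesis by (simp add: inner_self_nonpos_iff)
  next
    case False
    have xP: "x \<noteq> fst y $ i" for i
    proof
      assume "x = fst y $ i"
      then have "\<alpha> i * norm (x - snd y) + l i \<le> 0" using le[of i] by (simp add: dfun_def)
      moreover have "\<alpha> i * norm (x - snd y) \<ge> 0" using assms(2)[of i] by simp
      ultimately show False using assms(3)[of i] by linarith
    qed
    define e where "e = sgn (snd y - x)"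
    define u where "u i = sgn (fst y $ i - x)" for i
    have e1: "norm e = 1" and u1: "norm (u i) = 1" for i
      using False xP[of i] by (auto simp: e_def u_def norm_sgn)
    have uu: "u i \<bullet> u i = 1" for i using u1 by (simp add: norm_eq_1)
    have "p \<bullet> \<delta> \<le> 0" if \<delta>: "\<And>i. \<alpha> i * (e \<bullet> snd \<delta>) \<le> u i \<bullet> fst \<delta> $ i" for \<delta> :: "('n, 'm) state"
    proof -
      \<comment> \<open>Moving each pursuer straight away from \<open>x\<close> makes the weak
        inequalities strict, as \<open>dfun_decreasing_direction\<close> requires; letting
        \<open>\<epsilon>\<close> tend to 0 recovers \<open>\<delta>\<close>.\<close>
      define w :: "('n, 'm) state" where "w = ((\<chi> i. u i), 0)"
      have "p \<bullet> (\<delta> + \<epsilon> *\<^sub>R w) \<le> 0" if "\<epsilon> > 0" for \<epsilon>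
      proof (rule nonpos, rule dfun_decreasing_direction[OF xP False le])
        fix i
        show "\<alpha> i * (sgn (snd y - x) \<bullet> snd (\<delta> + \<epsilon> *\<^sub>R w))
            < sgn (fst y $ i - x) \<bullet> fst (\<delta> + \<epsilon> *\<^sub>R w) $ i"
          using \<delta>[of i] that
          by (simp add: w_def inner_add_right uu flip: e_def u_def)
      qed
      then have "eventually (\<lambda>\<epsilon>. p \<bullet> (\<delta> + \<epsilon> *\<^sub>R w) \<le> 0) (at_right 0)"
        using eventually_at_right_less[of "0::real"] by (auto elim: eventually_mono)
      moreover have "((\<lambda>\<epsilon>. p \<bullet> (\<delta> + \<epsilon> *\<^sub>R w)) \<longlongrightarrow> p \<bullet> (\<delta> + 0 *\<^sub>R w)) (at_right 0)"
        by (intro tendsto_intros)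
      ultimately have "p \<bullet> (\<delta> + 0 *\<^sub>R w) \<le> 0"
        by (intro tendsto_upperbound) auto
      then show ?thesis by simp
    qed
    moreover have "\<alpha> i \<ge> 0" for i using assms(2)[of i] by simp
    ultimately have "norm (snd p) = (\<Sum>i\<in>UNIV. \<alpha> i * norm (fst p $ i))"
      using e1 u1 by (intro dual_cone_norm_eq[where e = e and u = u]) blast+
    then show ?thesis by simp
  qed
qed

end
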